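(* Let $G$ be a simple graph with vertices $v_1,\dots,v_n$ and adjacency matrix $A\in\mathbb F_2^{n\times n}$, and suppose that either every vertex of $G$ has odd degree, and put $\bar N:=A+A^2$; or every vertex of $G$ has even degree (zero allowed), and put $\bar N:=A+A^2+\mathbb I$. Let $r$ be the rank of $\bar N$ over $\mathbb F_2$, let $w_1,\dots,w_{n-r}$ be a basis of $\ker\bar N$ and let $J\in\mathbb F_2^{(n-r)\times n}$ have rows $w_1^\top,\dots,w_{n-r}^\top$. Then in the Neighborhood Lights Out game on $G$, an initial state $i$ can be transformed into a final state $f$ if and only if $Ji=Jf$.
   Context: Neighborhood Lights Out game on $G$ (played only when all degrees are odd, or all degrees are even/zero): a state is $x\in\mathbb F_2^n$ ($x_j=1$ means the light at $v_j$ is on). Pressing the button at $v_i$ toggles the light at $v_i$ and the light at each vertex $v_k\neq v_i$ joined to $v_i$ by an odd total number of paths of length $1$ or $2$ (vertices joined by an even number of such paths keep their status). Arithmetic over $\mathbb F_2$. A state $i$ can be transformed into $f$ if some finite sequence of button presses turns $i$ into $f$. *)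

theory Defs
  imports
    "Graph_Theory.Pair_Digraph"
    "Jordan_Normal_Form.Matrix_Kernel"
    "Jordan_Normal_Form.DL_Rank"
    "HOL-Library.Z2"
begin

text \<open>
  The field with two elements is the type \<open>bit\<close>. A simple graph is a \<^locale>\<open>pair_graph\<close>: each edge
  \<open>{u, w}\<close> is represented by the two arcs \<open>(u, w)\<close> and \<open>(w, u)\<close>, so that the degree of a vertex
  is its out-degree. The vertices are enumerated by a bijection \<open>v\<close> from \<open>{..<n}\<close> onto the
  vertex set, with indices starting at \<open>0\<close>.
\<close>

definition adjacency_matrix :: "'a pair_pre_digraph \<Rightarrow> (nat \<Rightarrow> 'a) \<Rightarrow> nat \<Rightarrow> bit mat" where
  "adjacency_matrix G v n = mat n n (\<lambda>(j, k). if (v j, v k) \<in> parcs G then 1 else 0)"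

text \<open>
  Paths do not repeat vertices. A path is given by its list of arcs, so the length of the list is
  the length of the path; between two fixed end points, such lists correspond one-to-one to
  undirected paths.
\<close>

definition paths_1_or_2 :: "'a pair_pre_digraph \<Rightarrow> 'a \<Rightarrow> 'a \<Rightarrow> ('a \<times> 'a) awalk set" where
  "paths_1_or_2 G u w =
     {p. pre_digraph.apath (with_proj G) u p w \<and> (length p = 1 \<or> length p = 2)}"

definition press ::
  "'a pair_pre_digraph \<Rightarrow> (nat \<Rightarrow> 'a) \<Rightarrow> nat \<Rightarrow> nat \<Rightarrow> bit vec \<Rightarrow> bit vec" where
  "press G v n b x =
     vec n (\<lambda>k. if k = b \<or> (k \<noteq> b \<and> odd (card (paths_1_or_2 G (v b) (v k))))
                then x $ k + 1 else x $ k)"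

definition transformable ::
  "'a pair_pre_digraph \<Rightarrow> (nat \<Rightarrow> 'a) \<Rightarrow> nat \<Rightarrow> bit vec \<Rightarrow> bit vec \<Rightarrow> bool" where
  "transformable G v n x y \<longleftrightarrow>
     (\<exists>bs. set bs \<subseteq> {..<n} \<and> fold (press G v n) bs x = y)"

end

theory Submission
  imports Defs
begin

text \<open>
  Pressing button \<open>b\<close> adds column \<open>b\<close> of the symmetric matrix \<open>N\<close> to the state, the parity of the
  degrees making its diagonal equal to one. Hence the reachable states are those whose difference
  from \<open>i\<close> lies in the column space of \<open>N\<close>. By symmetry this is the row space, the orthogonal
  complement of \<open>ker N\<close>, and \<open>J\<close> tests orthogonality to a basis of \<open>ker N\<close>.
\<close>

section \<open>Orthogonal complements over an arbitrary field\<close>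

lemma (in vec_space) ex_separating_vec:
  assumes "finite S" "S \<subseteq> carrier_vec n" "y \<in> carrier_vec n" "y \<notin> span S"
  shows "\<exists>w\<in>orthogonal_complement S. w \<bullet> y \<noteq> 0"
  using assms
proof (induction S arbitrary: y rule: finite_induct)
  case empty
  then have "y \<noteq> 0\<^sub>v n"
    unfolding span_def lincomb_def by force
  then obtain i where i: "i < n" "y $ i \<noteq> 0"
    using empty.prems(2) by (metis carrier_vecD eq_vecI index_zero_vec(1,2))
  then have "unit_vec n i \<bullet> y \<noteq> 0"
    using empty.prems(2) by (simp add: scalar_prod_left_unit)
  then show ?case
    by (auto simp: orthogonal_complement_def intro!: bexI[of _ "unit_vec n i"])
next
  case (insert c S)
  have c: "c \<in> carrier_vec n" and S: "S \<subseteq> carrier_vec n" and y: "y \<in> carrier_vec n"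
    using insert.prems by auto
  have span_mono: "span S \<subseteq> span (insert c S)"
    by (rule span_is_monotone) auto
  show ?case
  proof (cases "c \<in> span S")
    case True
    have "y \<notin> span S"
      using insert.prems(3) span_mono by auto
    then obtain w where w: "w \<in> orthogonal_complement S" "w \<bullet> y \<noteq> 0"
      using insert.IH S y by blast
    \<comment> \<open>Orthogonality to \<open>S\<close> extends to its span, which already contains
      \<open>c\<close>.\<close>
    have "w \<bullet> c = 0"
      using w(1) True in_orthogonal_complement_span[OF S]
      by (auto simp: orthogonal_complement_def)
    then show ?thesis
      using w by (auto simp: orthogonal_complement_def)
  next
    case False
    then obtain w0 where w0: "w0 \<in> orthogonal_complement S" "w0 \<bullet> c \<noteq> 0"
      using insert.IH S c by blast
    have w0c: "w0 \<in> carrier_vec n"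
      using w0(1) by (simp add: orthogonal_complement_def)
    \<comment> \<open>This \<open>t\<close> makes \<open>t \<cdot>\<^sub>v c + y\<close> orthogonal
      to \<open>w0\<close>. Applying the induction hypothesis to that vector rather than to
      \<open>y\<close> anticipates the later correction by \<open>w0\<close>.\<close>
    define t where "t = - (w0 \<bullet> y) / (w0 \<bullet> c)"
    have tc: "t \<cdot>\<^sub>v c \<in> span (insert c S)"
      by (intro smult_in_span subsetD[OF in_own_span]) (use c S in auto)
    have "t \<cdot>\<^sub>v c + y \<notin> span (insert c S)"
      using span_add[OF insert.prems(1) tc] y insert.prems(3) by simp
    then have "t \<cdot>\<^sub>v c + y \<notin> span S"
      using span_mono by auto
    then obtain w1 where w1: "w1 \<in> orthogonal_complement S" "w1 \<bullet> (t \<cdot>\<^sub>v c + y) \<noteq> 0"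
      using insert.IH S c y by (metis add_carrier_vec smult_carrier_vec)
    have w1c: "w1 \<in> carrier_vec n"
      using w1(1) by (simp add: orthogonal_complement_def)
    \<comment> \<open>The value of \<open>s\<close> is forced by \<open>w \<bullet> c = 0\<close>.
      Then \<open>s * (w0 \<bullet> y) = t * (w1 \<bullet> c)\<close>, so \<open>w\<close> has the
      same nonzero product with \<open>y\<close> as \<open>w1\<close> has with
      \<open>t \<cdot>\<^sub>v c + y\<close>.\<close>
    define s where "s = - (w1 \<bullet> c) / (w0 \<bullet> c)"
    define w where "w = w1 + s \<cdot>\<^sub>v w0"
    have w_prod: "w \<bullet> z = w1 \<bullet> z + s * (w0 \<bullet> z)" if "z \<in> carrier_vec n" for z
      using that w0c w1c by (simp add: w_def add_scalar_prod_distrib[where n = n])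
    have "w \<bullet> z = 0" if "z \<in> S" for z
      using that w0(1) w1(1) S w_prod by (auto simp: orthogonal_complement_def)
    moreover have "w \<bullet> c = 0"
      using w_prod[OF c] w0(2) by (simp add: s_def)
    moreover have "w \<bullet> y = w1 \<bullet> (t \<cdot>\<^sub>v c + y)"
      using w_prod[OF y] c y w1c by (simp add: scalar_prod_add_distrib[where n = n] s_def t_def)
    moreover have "w \<in> carrier_vec n"
      using w0c w1c by (simp add: w_def)
    ultimately have "w \<in> orthogonal_complement (insert c S)" "w \<bullet> y \<noteq> 0"
      using w1(2) by (auto simp: orthogonal_complement_def)
    then show ?thesis
      by blast
  qed
qed

text \<open>A vector outside the span is detected by a separating vector. The argument makes no use
  of positivity, so it covers F_2, where a space may meet its own complement.\<close>

lemma (in vec_space) double_orthogonal_complement: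
  assumes "finite S" "S \<subseteq> carrier_vec n"
  shows "orthogonal_complement (orthogonal_complement S) = span S"
proof
  show "orthogonal_complement (orthogonal_complement S) \<subseteq> span S"
  proof
    fix y assume y: "y \<in> orthogonal_complement (orthogonal_complement S)"
    show "y \<in> span S"
    proof (rule ccontr)
      assume "y \<notin> span S"
      moreover have "y \<in> carrier_vec n"
        using y by (simp add: orthogonal_complement_def)
      ultimately obtain w where "w \<in> orthogonal_complement S" "w \<bullet> y \<noteq> 0"
        using ex_separating_vec[OF assms] by blast
      then show False
        using y comm_scalar_prod[of w n y] by (auto simp: orthogonal_complement_def)
    qed
  qed
  show "span S \<subseteq> orthogonal_complement (orthogonal_complement S)"
  proof
    fix y assume y: "y \<in> span S"
    have yc: "y \<in> carrier_vec n"
      using y span_closed[OF assms(2)] by simp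
    have "w \<bullet> y = 0" if "w \<in> orthogonal_complement S" for w
      using that y in_orthogonal_complement_span[OF assms(2)]
      by (auto simp: orthogonal_complement_def)
    then show "y \<in> orthogonal_complement (orthogonal_complement S)"
      using yc comm_scalar_prod[OF yc] by (auto simp: orthogonal_complement_def)
  qed
qed

text \<open>The entries of a matrix-vector product are the products with the rows. This serves both
  for the columns of \<open>N\<close>, as rows of its transpose, and for the rows of
  \<open>J\<close>.\<close>

lemma (in vec_space) orthogonal_complement_rows:
  assumes "N \<in> carrier_mat nr n"
  shows "orthogonal_complement (set (rows N)) = mat_kernel N"
proof -
  have "x \<bullet> row N j = row N j \<bullet> x" if "x \<in> carrier_vec n" "j < nr" for x j
    using that assms by (intro comm_scalar_prod[where n = n]) auto
  then show ?thesis
    using assms by (auto simp: orthogonal_complement_def mat_kernel rows_def vec_eq_iff)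
qed

lemma of_nat_bit: "(of_nat m :: bit) = of_bool (odd m)"
  by (induction m) (simp_all del: add_bit_eq_xor)

text \<open>In characteristic two every vector is its own negative, so the difference of two states
  is written as their sum.\<close>

lemma bit_vec_add_left_cancel:
  fixes x y :: "bit vec"
  assumes "x \<in> carrier_vec n" "y \<in> carrier_vec n"
  shows "x + (x + y) = y"
  using assms by (intro eq_vecI) auto

lemma bit_vec_add_eq_0_iff:
  fixes x y :: "bit vec"
  assumes "x \<in> carrier_vec n" "y \<in> carrier_vec n"
  shows "x + y = 0\<^sub>v n \<longleftrightarrow> x = y"
  using assms by (auto simp: vec_eq_iff)

section \<open>Path counts and the entries of the neighborhood matrix\<close>

text \<open>A path of length 2 is determined by its middle vertex. Since there are no loops and the
  end points differ, every walk of length 2 between them is a path.\<close>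

lemma (in pair_graph) card_paths_1_or_2:
  assumes "u \<noteq> w"
  shows "card (paths_1_or_2 G u w) =
    of_bool ((u, w) \<in> parcs G) + card {x. (u, x) \<in> parcs G \<and> (x, w) \<in> parcs G}"
proof -
  let ?M = "{x. (u, x) \<in> parcs G \<and> (x, w) \<in> parcs G}"
  let ?P = "{p. p = [(u, w)] \<and> (u, w) \<in> parcs G}"
  let ?Q = "(\<lambda>x. [(u, x), (x, w)]) ` ?M"
  have no_loops: "(x, x) \<notin> parcs G" for x
    using pair_no_loops by fastforce
  have "paths_1_or_2 G u w = ?P \<union> ?Q"
    using assms no_loops
    by (auto simp: paths_1_or_2_def apath_def awalk_def length_Suc_conv numeral_2_eq_2
        intro: wellformed')
  moreover have "finite ?M"
    by (rule finite_subset[OF _ pair_finite_verts]) (auto dest: wellformed')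
  moreover have "card ?P = of_bool ((u, w) \<in> parcs G)"
    by auto
  moreover have "card ?Q = card ?M"
    by (rule card_image) (auto simp: inj_on_def)
  moreover have "card (?P \<union> ?Q) = card ?P + card ?Q"
    using \<open>finite ?M\<close> by (intro card_Un_disjoint) auto
  ultimately show ?thesis
    by simp
qed

lemma adjacency_matrix_carrier: "adjacency_matrix G v n \<in> carrier_mat n n"
  by (simp add: adjacency_matrix_def)

lemma (in pair_graph) adjacency_matrix_square:
  assumes "bij_betw v {..<n} (pverts G)" "j < n" "k < n"
  shows "(adjacency_matrix G v n ^\<^sub>m 2) $$ (j, k) =
    of_nat (card {x. (v j, x) \<in> parcs G \<and> (x, v k) \<in> parcs G})"
proof -
  let ?M = "{x. (v j, x) \<in> parcs G \<and> (x, v k) \<in> parcs G}"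
  let ?I = "{l. l < n \<and> (v j, v l) \<in> parcs G \<and> (v l, v k) \<in> parcs G}"
  \<comment> \<open>Arcs join vertices of \<open>G\<close>, so every middle vertex has an index
    below \<open>n\<close>.\<close>
  have image: "v ` ?I = ?M"
    using assms(1) wellformed'(1) by (fastforce simp: bij_betw_def)
  have "inj_on v ?I"
    using assms(1) by (auto simp: bij_betw_def inj_on_def)
  then have card: "card ?M = card ?I"
    unfolding image[symmetric] by (rule card_image)
  have "(adjacency_matrix G v n ^\<^sub>m 2) $$ (j, k) =
      (\<Sum>l<n. of_bool ((v j, v l) \<in> parcs G \<and> (v l, v k) \<in> parcs G))"
    using assms(2,3)
    by (simp add: adjacency_matrix_def numeral_2_eq_2 scalar_prod_def lessThan_atLeast0)
      (rule arg_cong[where f = "\<lambda>S. of_nat (card S)"], auto)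
  also have "\<dots> = of_nat (card ?I)"
    by (simp add: sum_of_bool_eq Int_def)
  finally show ?thesis
    by (simp add: card)
qed

lemma (in pair_graph) parcs_commute: "(u, w) \<in> parcs G \<longleftrightarrow> (w, u) \<in> parcs G"
  using pair_sym_arcs by (auto simp: symmetric_def dest: symD)

lemma (in pair_graph) card_paths_1_or_2_commute:
  assumes "u \<noteq> w"
  shows "card (paths_1_or_2 G u w) = card (paths_1_or_2 G w u)"
proof -
  have "{x. (u, x) \<in> parcs G \<and> (x, w) \<in> parcs G} = {x. (w, x) \<in> parcs G \<and> (x, u) \<in> parcs G}"
    using parcs_commute by blast
  then show ?thesis
    using assms by (simp add: card_paths_1_or_2 parcs_commute[of u w])
qed

text \<open>Closed walks of length 2 at \<open>u\<close> go to a neighbour and back, so the diagonal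
  of the squared adjacency matrix holds the degrees mod 2.\<close>

lemma (in pair_graph) card_common_neighbours_self:
  "card {x. (u, x) \<in> parcs G \<and> (x, u) \<in> parcs G} = out_degree (with_proj G) u"
proof -
  have "out_arcs (with_proj G) u = Pair u ` {x. (u, x) \<in> parcs G \<and> (x, u) \<in> parcs G}"
    using parcs_commute by (auto simp: out_arcs_def)
  then show ?thesis
    by (simp add: out_degree_def card_image inj_on_def)
qed

text \<open>On the diagonal \<open>A\<close> gives 0 and its square gives the degree mod 2: this is
  1 for odd degrees, and for even degrees the identity matrix supplies the 1. Off the diagonal,
  \<open>A + A ^\<^sub>m 2\<close> counts paths mod 2. Column \<open>k\<close> thus records the
  effect of button \<open>k\<close>.\<close>

lemma (in pair_graph) neighborhood_matrix_index:
  assumes v: "bij_betw v {..<n} (pverts G)" and A: "A = adjacency_matrix G v n"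
    and N: "((\<forall>u\<in>pverts G. odd (out_degree (with_proj G) u)) \<and> N = A + A ^\<^sub>m 2)
       \<or> ((\<forall>u\<in>pverts G. even (out_degree (with_proj G) u)) \<and> N = A + A ^\<^sub>m 2 + 1\<^sub>m n)"
    and j: "j < n" and k: "k < n"
  shows "N $$ (j, k) = of_bool (j = k \<or> odd (card (paths_1_or_2 G (v k) (v j))))"
proof -
  have Ac: "A \<in> carrier_mat n n" and A2c: "A ^\<^sub>m 2 \<in> carrier_mat n n"
    using A by (auto simp: adjacency_matrix_carrier)
  have A_index: "A $$ (j, k) = of_bool ((v j, v k) \<in> parcs G)"
    using j k by (simp add: A adjacency_matrix_def)
  note A2_index = adjacency_matrix_square[OF v j k, folded A]
  show ?thesis
  proof (cases "j = k")
    case True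
    have "v j \<in> pverts G"
      using v j by (auto simp: bij_betw_def)
    then show ?thesis
      using N True j k Ac A2c A_index A2_index pair_no_loops[of "(v j, v j)"]
      by (auto simp: card_common_neighbours_self of_nat_bit simp del: add_bit_eq_xor)
  next
    case False
    then have "v j \<noteq> v k"
      using v j k by (auto simp: bij_betw_def inj_on_def)
    then have "(of_nat (card (paths_1_or_2 G (v k) (v j))) :: bit) = A $$ (j, k) + (A ^\<^sub>m 2) $$ (j, k)"
      \<comment> \<open>Paths are reversed: \<open>press\<close> counts them from the pressed
        button, whereas the matrix entry reads from row to column.\<close>
      unfolding card_paths_1_or_2_commute[OF \<open>v j \<noteq> v k\<close>, symmetric]
      by (simp add: card_paths_1_or_2 A_index A2_index del: add_bit_eq_xor)
    also have "\<dots> = N $$ (j, k)"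
      using N False j k Ac A2c by (auto simp del: add_bit_eq_xor)
    finally show ?thesis
      using False by (simp add: of_nat_bit)
  qed
qed

section \<open>Reachable states and the column space\<close>

text \<open>The kernel of the transpose is the orthogonal complement of the columns. Its elements
  give invariants of the game, and these suffice because the double complement of the columns is
  their span.\<close>

lemma transformable_iff_orthogonal_kernel:
  assumes N: "N \<in> carrier_mat n n"
    and press: "\<And>b x. b < n \<Longrightarrow> x \<in> carrier_vec n \<Longrightarrow> press G v n b x = x + col N b"
    and x: "x \<in> carrier_vec n" and y: "y \<in> carrier_vec n"
  shows "transformable G v n x y \<longleftrightarrow> (\<forall>w\<in>mat_kernel N\<^sup>T. w \<bullet> (x + y) = 0)"
proof
  assume "transformable G v n x y"
  then obtain bs where bs: "set bs \<subseteq> {..<n}" "fold (press G v n) bs x = y"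
    by (auto simp: transformable_def)
  show "\<forall>w\<in>mat_kernel N\<^sup>T. w \<bullet> (x + y) = 0"
  proof
    fix w assume w: "w \<in> mat_kernel N\<^sup>T"
    have wc: "w \<in> carrier_vec n" and "N\<^sup>T *\<^sub>v w = 0\<^sub>v n"
      using mat_kernelD[of "N\<^sup>T" n n w] N w by auto
    have "w \<bullet> col N b = 0" if "b < n" for b
    proof -
      have "w \<bullet> col N b = col N b \<bullet> w"
        using wc N that by (intro comm_scalar_prod[where n = n]) auto
      also have "\<dots> = (N\<^sup>T *\<^sub>v w) $ b"
        using N that by simp
      finally show ?thesis
        using \<open>N\<^sup>T *\<^sub>v w = 0\<^sub>v n\<close> that by simp
    qed
    \<comment> \<open>Each press adds a column orthogonal to \<open>w\<close>, so the product with
      \<open>w\<close> never changes.\<close>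
    then have "w \<bullet> fold (press G v n) bs x = w \<bullet> x"
      using bs(1) x
    proof (induction bs arbitrary: x)
      case (Cons b bs)
      then show ?case
        using wc N col_carrier_vec[of b n N n] by (simp add: press scalar_prod_add_distrib[where n = n] del: add_bit_eq_xor)
    qed simp
    then show "w \<bullet> (x + y) = 0"
      using bs(2) wc x y by (simp add: scalar_prod_add_distrib[where n = n])
  qed
next
  assume orth: "\<forall>w\<in>mat_kernel N\<^sup>T. w \<bullet> (x + y) = 0"
  interpret vec_space "TYPE(bit)" n .
  \<comment> \<open>These are the differences achievable from every state. Quantifying over the
    start makes the set closed under addition, by concatenating button sequences.\<close>
  let ?D = "{d \<in> carrier_vec n. \<forall>x\<in>carrier_vec n. transformable G v n x (x + d)}"
  have cols: "set (cols N) \<subseteq> carrier_vec n"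
    using N cols_dim by blast
  have "x + y \<in> orthogonal_complement (orthogonal_complement (set (cols N)))"
    using orth x y N orthogonal_complement_rows[of "N\<^sup>T" n]
      comm_scalar_prod[OF add_carrier_vec[OF x y]] mat_kernel_carrier[of "N\<^sup>T" n n]
    by (auto simp: orthogonal_complement_def[of "mat_kernel _"])
  then have "x + y \<in> span (set (cols N))"
    using double_orthogonal_complement[OF _ cols] by simp
  moreover have zero_D: "0\<^sub>v n \<in> ?D"
    by (auto simp: transformable_def intro!: exI[of _ "[]"])
  have "span (set (cols N)) \<subseteq> ?D"
  proof (rule span_is_subset)
    show "set (cols N) \<subseteq> ?D"
    proof
      fix d assume "d \<in> set (cols N)"
      then obtain b where b: "b < n" "d = col N b"
        using N by (auto simp: cols_def)
      have "transformable G v n x (x + d)" if "x \<in> carrier_vec n" for x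
        using b that by (auto simp: transformable_def press intro!: exI[of _ "[b]"])
      then show "d \<in> ?D"
        using b N by auto
    qed
    show "submodule class_ring ?D V"
    proof (rule submodule.intro)
      fix d e assume d: "d \<in> ?D" and e: "e \<in> ?D"
      have "transformable G v n x (x + (d + e))" if x: "x \<in> carrier_vec n" for x
      proof -
        have "transformable G v n x (x + d)" "transformable G v n (x + d) (x + d + e)"
          using d e x by (auto simp del: assoc_add_vec)
        then obtain bs cs where "set bs \<subseteq> {..<n}" "fold (press G v n) bs x = x + d"
          "set cs \<subseteq> {..<n}" "fold (press G v n) cs (x + d) = x + d + e"
          by (auto simp: transformable_def)
        then show ?thesis
          using d e x unfolding transformable_def
          by (intro exI[of _ "bs @ cs"]) (auto simp: assoc_add_vec[of _ n])
      qed
      then show "d \<oplus>\<^bsub>V\<^esub> e \<in> ?D"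
        using d e by auto
    next
      \<comment> \<open>The only scalars are 0 and 1.\<close>
      fix c :: bit and d assume "d \<in> ?D"
      then show "c \<odot>\<^bsub>V\<^esub> d \<in> ?D"
        using zero_D by (cases c) auto
    qed (use zero_D module_axioms in auto)
  qed
  ultimately have "transformable G v n x (x + (x + y))"
    using x by auto
  then show "transformable G v n x y"
    using bit_vec_add_left_cancel[OF x y] by simp
qed

section \<open>Testing reachability with a kernel basis\<close>

theorem theorem5:
  fixes G :: "'a pair_pre_digraph" and v :: "nat \<Rightarrow> 'a" and n r :: nat
    and A N J :: "bit mat" and ws :: "bit vec list" and i f :: "bit vec"
  assumes "pair_graph G"
    and "bij_betw v {..<n} (pverts G)"
    and "A = adjacency_matrix G v n"
    and "((\<forall>u\<in>pverts G. odd (out_degree (with_proj G) u)) \<and> N = A + A ^\<^sub>m 2)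
       \<or> ((\<forall>u\<in>pverts G. even (out_degree (with_proj G) u)) \<and> N = A + A ^\<^sub>m 2 + 1\<^sub>m n)"
    and "r = vec_space.rank n N"
    and "length ws = n - r" and "distinct ws" and "kernel.basis n N (set ws)"
    and "J = mat_of_rows n ws"
    and "i \<in> carrier_vec n" and "f \<in> carrier_vec n"
  shows "transformable G v n i f \<longleftrightarrow> J *\<^sub>v i = J *\<^sub>v f"
proof -
  interpret pair_graph G by fact
  have N: "N \<in> carrier_mat n n"
    using assms(3,4) adjacency_matrix_carrier[of G v n] by auto
  interpret K: kernel n n N by unfold_locales (rule N)
  have ws: "set ws \<subseteq> mat_kernel N"
    using assms(8) unfolding K.Ker.basis_def by blast
  then have ws_carrier: "set ws \<subseteq> carrier_vec n"
    using mat_kernel_carrier[OF N] by blast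
  have J: "J \<in> carrier_mat (length ws) n"
    by (simp add: assms(9))
  have sum: "i + f \<in> carrier_vec n"
    using assms(10,11) by simp
  have comm: "(i + f) \<bullet> w = w \<bullet> (i + f)" if "w \<in> mat_kernel N" for w
    using that mat_kernel_carrier[OF N] comm_scalar_prod[OF sum] by blast
  note N_index = neighborhood_matrix_index[OF assms(2-4)]
  \<comment> \<open>Symmetry of \<open>N\<close> comes from reversing paths, and it identifies the
    kernel of the transpose with \<open>mat_kernel N\<close>.\<close>
  have "N $$ (j, k) = N $$ (k, j)" if "j < n" "k < n" for j k
  proof (cases "j = k")
    case False
    then have "v j \<noteq> v k"
      using assms(2) that by (auto simp: bij_betw_def inj_on_def)
    then show ?thesis
      using that by (auto simp: N_index card_paths_1_or_2_commute)
  qed simp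
  then have "N\<^sup>T = N"
    using N by (intro eq_matI) auto
  moreover have "press G v n b x = x + col N b" if "b < n" "x \<in> carrier_vec n" for b x
    using that N by (intro eq_vecI) (auto simp: press_def N_index)
  ultimately have "transformable G v n i f \<longleftrightarrow> (\<forall>w\<in>mat_kernel N. w \<bullet> (i + f) = 0)"
    using transformable_iff_orthogonal_kernel[OF N _ assms(10,11), of G v] by simp
  also have "\<dots> \<longleftrightarrow> i + f \<in> K.NC.orthogonal_complement (mat_kernel N)"
    using sum comm by (simp add: K.NC.orthogonal_complement_def)
  \<comment> \<open>The basis property concerns the kernel as a space of its own;
    \<open>K.span_same\<close> carries the span over to the full space.\<close>
  also have "mat_kernel N = K.NC.span (set ws)"
    using assms(8) K.span_same[OF ws] unfolding K.Ker.basis_def by simp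
  also have "K.NC.orthogonal_complement \<dots> = K.NC.orthogonal_complement (set ws)"
    using ws_carrier by (rule K.NC.in_orthogonal_complement_span)
  \<comment> \<open>The rows of \<open>J\<close> are the basis vectors \<open>ws\<close>.\<close>
  also have "\<dots> = mat_kernel J"
    using K.NC.orthogonal_complement_rows[OF J] ws_carrier by (simp add: assms(9))
  also have "i + f \<in> mat_kernel J \<longleftrightarrow> J *\<^sub>v i + J *\<^sub>v f = 0\<^sub>v (length ws)"
    using J sum assms(10,11) by (simp add: mat_kernel mult_add_distrib_mat_vec)
  also have "\<dots> \<longleftrightarrow> J *\<^sub>v i = J *\<^sub>v f"
    using J assms(10,11) by (intro bit_vec_add_eq_0_iff) auto
  finally show ?thesis .
qed

end
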